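(* Let $X$, $Y$ be disjoint sets of cardinality at least two, and suppose $M \le \mathrm{Sym}(X)$ and $N \le \mathrm{Sym}(Y)$ are nontrivial and closed. Then $M\boxtimes N$ is closed in $\mathrm{Sym}(V_Y)$, and the following are equivalent: (1) every point stabiliser in $M\boxtimes N$ is compact in $\mathrm{Sym}(V_Y)$; (2) $N$ is compact and every point stabiliser in $M$ is compact.
   Context: All topologies are permutation topologies: for a set $V$, $\mathrm{Sym}(V)$ has the topology of pointwise convergence, in which the pointwise stabilisers of finite subsets of $V$ form a basis of neighbourhoods of the identity; subgroups carry the subspace topology. Let $T$ be the $(|X|,|Y|)$-biregular tree with natural bipartition $VT=V_X\sqcup V_Y$ (vertices in $V_X$ have valency $|X|$, in $V_Y$ valency $|Y|$). For a vertex $v$, $A(v)$ (resp. $\overline{A}(v)$) is the set of arcs (ordered pairs of adjacent vertices) with origin (resp. terminus) $v$. A legal colouring is a map $c:AT\to X\cup Y$ restricting to a bijection $A(v)\to X$ for $v\in V_X$, to a bijection $A(v)\to Y$ for $v\in V_Y$, and constant on each $\overline{A}(v)$. $U_c(M,N)$ is the group of $g\in\mathrm{Aut}(T)$ with $gV_X=V_X$ and $c|_{A(gv)}\circ g|_{A(v)}\circ(c|_{A(v)})^{-1}$ in $M$ for all $v\in V_X$ and in $N$ for all $v\in V_Y$. The box product $M\boxtimes N\le\mathrm{Sym}(V_Y)$ is the group induced on $V_Y$ by $U_c(M,N)$ (independent of $c$ up to permutation isomorphism). *)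

theory Defs
  imports "HOL-Analysis.Analysis" "HOL-Combinatorics.Permutations"
begin

section \<open>Permutation topology\<close>

text \<open>Sym(S) is the set of permutations of S, represented as functions fixing
  every point outside S. The topology of pointwise convergence is the product
  topology of discrete spaces (coordinates outside S are constant on Sym(S)).\<close>

definition Sym :: "'a set \<Rightarrow> ('a \<Rightarrow> 'a) set" where
  "Sym S = {p. p permutes S}"

definition pointwise_top :: "('a \<Rightarrow> 'a) topology" where
  "pointwise_top = product_topology (\<lambda>_. discrete_topology UNIV) UNIV"

definition sym_top :: "'a set \<Rightarrow> ('a \<Rightarrow> 'a) topology" where
  "sym_top S = subtopology pointwise_top (Sym S)"

definition perm_group :: "'a set \<Rightarrow> ('a \<Rightarrow> 'a) set \<Rightarrow> bool" where
  "perm_group S G \<longleftrightarrow> G \<subseteq> Sym S \<and> id \<in> G \<and>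
     (\<forall>g\<in>G. \<forall>h\<in>G. g \<circ> h \<in> G) \<and> (\<forall>g\<in>G. inv g \<in> G)"

definition stab :: "('a \<Rightarrow> 'a) set \<Rightarrow> 'a \<Rightarrow> ('a \<Rightarrow> 'a) set" where
  "stab G x = {g \<in> G. g x = x}"

section \<open>Trees, arcs, colourings\<close>

text \<open>A graph on vertex set V with symmetric irreflexive adjacency E.
  Arcs are ordered pairs of adjacent vertices.\<close>

definition arcs :: "('v \<Rightarrow> 'v \<Rightarrow> bool) \<Rightarrow> ('v \<times> 'v) set" where
  "arcs E = {(u, w). E u w}"

definition arcs_from :: "('v \<Rightarrow> 'v \<Rightarrow> bool) \<Rightarrow> 'v \<Rightarrow> ('v \<times> 'v) set" where
  "arcs_from E v = {(u, w). E u w \<and> u = v}"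

definition arcs_to :: "('v \<Rightarrow> 'v \<Rightarrow> bool) \<Rightarrow> 'v \<Rightarrow> ('v \<times> 'v) set" where
  "arcs_to E v = {(u, w). E u w \<and> w = v}"

text \<open>A tree: nonempty, connected, and every edge is a bridge (i.e. acyclic).\<close>
definition is_tree :: "'v set \<Rightarrow> ('v \<Rightarrow> 'v \<Rightarrow> bool) \<Rightarrow> bool" where
  "is_tree V E \<longleftrightarrow> V \<noteq> {} \<and>
     (\<forall>u w. E u w \<longrightarrow> u \<in> V \<and> w \<in> V \<and> u \<noteq> w \<and> E w u) \<and>
     (\<forall>u\<in>V. \<forall>w\<in>V. (u, w) \<in> (arcs E)\<^sup>*) \<and>
     (\<forall>u w. E u w \<longrightarrow> (u, w) \<notin> (arcs E - {(u, w), (w, u)})\<^sup>*)"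

text \<open>The (|X|,|Y|)-biregular tree with natural bipartition VX, VY.\<close>
definition biregular_tree ::
  "'a set \<Rightarrow> 'a set \<Rightarrow> 'v set \<Rightarrow> 'v set \<Rightarrow> ('v \<Rightarrow> 'v \<Rightarrow> bool) \<Rightarrow> bool" where
  "biregular_tree X Y VX VY E \<longleftrightarrow> is_tree (VX \<union> VY) E \<and> VX \<inter> VY = {} \<and>
     (\<forall>u w. E u w \<longrightarrow> (u \<in> VX \<and> w \<in> VY) \<or> (u \<in> VY \<and> w \<in> VX)) \<and>
     (\<forall>v\<in>VX. arcs_from E v \<approx> X) \<and> (\<forall>v\<in>VY. arcs_from E v \<approx> Y)"

definition legal_colouring ::
  "'a set \<Rightarrow> 'a set \<Rightarrow> 'v set \<Rightarrow> 'v set \<Rightarrow> ('v \<Rightarrow> 'v \<Rightarrow> bool) \<Rightarrow> ('v \<times> 'v \<Rightarrow> 'a) \<Rightarrow> bool" where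
  "legal_colouring X Y VX VY E c \<longleftrightarrow>
     (\<forall>v\<in>VX. bij_betw c (arcs_from E v) X) \<and>
     (\<forall>v\<in>VY. bij_betw c (arcs_from E v) Y) \<and>
     (\<forall>v. \<forall>a\<in>arcs_to E v. \<forall>b\<in>arcs_to E v. c a = c b)"

text \<open>Automorphisms of the graph (V, E), as permutations of V.\<close>
definition graph_aut :: "'v set \<Rightarrow> ('v \<Rightarrow> 'v \<Rightarrow> bool) \<Rightarrow> ('v \<Rightarrow> 'v) set" where
  "graph_aut V E = {g. g permutes V \<and> (\<forall>u\<in>V. \<forall>w\<in>V. E u w \<longleftrightarrow> E (g u) (g w))}"

text \<open>Local action c|A(gv) o g|A(v) o (c|A(v))^-1, as a permutation of the colour set
  at v (identity on other points).\<close>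
definition local_action ::
  "('v \<Rightarrow> 'v \<Rightarrow> bool) \<Rightarrow> ('v \<times> 'v \<Rightarrow> 'a) \<Rightarrow> ('v \<Rightarrow> 'v) \<Rightarrow> 'v \<Rightarrow> 'a \<Rightarrow> 'a" where
  "local_action E c g v = (\<lambda>x. if x \<in> c ` arcs_from E v
      then c (g v, g (THE w. E v w \<and> c (v, w) = x)) else x)"

definition U_c ::
  "'a set \<Rightarrow> 'a set \<Rightarrow> 'v set \<Rightarrow> 'v set \<Rightarrow> ('v \<Rightarrow> 'v \<Rightarrow> bool) \<Rightarrow> ('v \<times> 'v \<Rightarrow> 'a)
   \<Rightarrow> ('a \<Rightarrow> 'a) set \<Rightarrow> ('a \<Rightarrow> 'a) set \<Rightarrow> ('v \<Rightarrow> 'v) set" where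
  "U_c X Y VX VY E c M N = {g \<in> graph_aut (VX \<union> VY) E. g ` VX = VX \<and>
      (\<forall>v\<in>VX. local_action E c g v \<in> M) \<and> (\<forall>v\<in>VY. local_action E c g v \<in> N)}"

text \<open>The box product: the permutation group induced on VY by U_c(M,N).\<close>
definition box_product ::
  "'a set \<Rightarrow> 'a set \<Rightarrow> 'v set \<Rightarrow> 'v set \<Rightarrow> ('v \<Rightarrow> 'v \<Rightarrow> bool) \<Rightarrow> ('v \<times> 'v \<Rightarrow> 'a)
   \<Rightarrow> ('a \<Rightarrow> 'a) set \<Rightarrow> ('a \<Rightarrow> 'a) set \<Rightarrow> ('v \<Rightarrow> 'v) set" where
  "box_product X Y VX VY E c M N =
     (\<lambda>g. \<lambda>y. if y \<in> VY then g y else y) ` U_c X Y VX VY E c M N"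

end

theory Submission
  imports Defs
begin

text \<open>A closed permutation group is compact iff all its orbits are finite. A vertex of \<open>VX\<close>
  is recovered from any two of its neighbours, so a pointwise limit on \<open>VY\<close> of tree
  automorphisms extends to the whole tree, and its local actions are limits of local actions;
  hence the box product is closed. If \<open>N\<close> and the point stabilisers of \<open>M\<close> have finite
  orbits, finiteness of the orbits of a vertex stabiliser propagates along paths. Conversely, every
  \<open>m \<in> M\<close> (or \<open>n \<in> N\<close>) is realised by an automorphism fixing a given vertex of \<open>VX\<close>
  (or \<open>VY\<close>) that has this permutation as its local action at every vertex of that side and
  the identity on the other side, so infinite orbits of the local groups give infinite orbits in
  the tree.\<close>

section \<open>Closed and compact permutation groups\<close>

lemma bij_moving_only_imp_permutes:
  assumes "bij p" "\<And>x. x \<notin> S \<Longrightarrow> p x = x"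
  shows "p permutes S"
  using assms unfolding permutes_def bij_iff by blast

lemma openin_pointwise_top_cylinder:
  assumes "finite F"
  shows "openin pointwise_top {g. \<forall>x\<in>F. g x = p x}"
proof -
  have "{g. \<forall>x\<in>F. g x = p x} = PiE UNIV (\<lambda>x. if x \<in> F then {p x} else UNIV)"
    by (auto simp: PiE_def Pi_def split: if_splits)
  moreover have "finite {x. (if x \<in> F then {p x} else UNIV) \<noteq> UNIV}"
    by (rule finite_subset[OF _ assms]) auto
  ultimately show ?thesis
    unfolding pointwise_top_def by (simp add: openin_PiE_gen)
qed

lemma topspace_pointwise_top [simp]: "topspace pointwise_top = UNIV"
  by (auto simp: pointwise_top_def)

lemma pointwise_top_neighbourhood:
  assumes "openin pointwise_top T" "p \<in> T"
  obtains F where "finite F" "{g. \<forall>x\<in>F. g x = p x} \<subseteq> T"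
proof -
  obtain W where W: "finite {i. W i \<noteq> UNIV}" "p \<in> PiE UNIV W" "PiE UNIV W \<subseteq> T"
    using assms unfolding pointwise_top_def openin_product_topology_alt by auto
  have "{g. \<forall>x\<in>{i. W i \<noteq> UNIV}. g x = p x} \<subseteq> PiE UNIV W"
    using W(2) by (auto simp: PiE_def Pi_def) (metis UNIV_I)
  with W show ?thesis by (intro that[of "{i. W i \<noteq> UNIV}"]) auto
qed

text \<open>The cylinders over finite sets form a neighbourhood basis of \<open>p\<close>, so the
  inner condition says that \<open>p\<close> lies in the closure of \<open>G\<close>.\<close>

lemma closedin_pointwise_top_iff:
  "closedin pointwise_top G \<longleftrightarrow>
     (\<forall>p. (\<forall>F. finite F \<longrightarrow> (\<exists>g\<in>G. \<forall>x\<in>F. g x = p x)) \<longrightarrow> p \<in> G)"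
proof
  assume G: "closedin pointwise_top G"
  show "\<forall>p. (\<forall>F. finite F \<longrightarrow> (\<exists>g\<in>G. \<forall>x\<in>F. g x = p x)) \<longrightarrow> p \<in> G"
  proof (intro allI impI, rule ccontr)
    fix p assume p: "\<forall>F. finite F \<longrightarrow> (\<exists>g\<in>G. \<forall>x\<in>F. g x = p x)" and "p \<notin> G"
    have "openin pointwise_top (- G)"
      using G by (simp only: closedin_def topspace_pointwise_top Compl_eq_Diff_UNIV subset_UNIV simp_thms)
    then obtain F where "finite F" "{g. \<forall>x\<in>F. g x = p x} \<subseteq> - G"
      using \<open>p \<notin> G\<close> pointwise_top_neighbourhood[of "- G" p] by blast
    with p show False by blast
  qed
next
  assume R: "\<forall>p. (\<forall>F. finite F \<longrightarrow> (\<exists>g\<in>G. \<forall>x\<in>F. g x = p x)) \<longrightarrow> p \<in> G"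
  have "openin pointwise_top (- G)"
  proof (subst openin_subopen, intro ballI)
    fix p assume "p \<in> - G"
    then have "\<not> (\<forall>F. finite F \<longrightarrow> (\<exists>g\<in>G. \<forall>x\<in>F. g x = p x))"
      using R[THEN spec, of p] by simp
    then obtain F where "finite F" "\<forall>g\<in>G. \<not> (\<forall>x\<in>F. g x = p x)" by blast
    then show "\<exists>T. openin pointwise_top T \<and> p \<in> T \<and> T \<subseteq> - G"
      by (intro exI[of _ "{g. \<forall>x\<in>F. g x = p x}"]) (auto simp: openin_pointwise_top_cylinder)
  qed
  then show "closedin pointwise_top G"
    by (simp only: closedin_def topspace_pointwise_top Compl_eq_Diff_UNIV subset_UNIV simp_thms)
qed

lemma closedin_sym_top_iff:
  "closedin (sym_top S) G \<longleftrightarrow> G \<subseteq> Sym S \<and>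
     (\<forall>p\<in>Sym S. (\<forall>F. finite F \<longrightarrow> (\<exists>g\<in>G. \<forall>x\<in>F. g x = p x)) \<longrightarrow> p \<in> G)"
  (is "?L \<longleftrightarrow> ?R")
proof
  assume ?L
  then obtain T where T: "closedin pointwise_top T" "G = T \<inter> Sym S"
    unfolding sym_top_def closedin_subtopology by blast
  show ?R
  proof (intro conjI ballI impI)
    fix p assume "p \<in> Sym S" and "\<forall>F. finite F \<longrightarrow> (\<exists>g\<in>G. \<forall>x\<in>F. g x = p x)"
    then have "\<forall>F. finite F \<longrightarrow> (\<exists>g\<in>T. \<forall>x\<in>F. g x = p x)" using T(2) by blast
    then have "p \<in> T" using T(1) unfolding closedin_pointwise_top_iff by blast
    then show "p \<in> G" using \<open>p \<in> Sym S\<close> T(2) by blast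
  qed (use T(2) in blast)
next
  assume R: ?R
  \<comment> \<open>\<open>?T\<close> is the closure of \<open>G\<close> in the space of all
    functions; its trace on \<open>Sym S\<close> is \<open>G\<close> itself.\<close>
  let ?T = "{p. \<forall>F. finite F \<longrightarrow> (\<exists>g\<in>G. \<forall>x\<in>F. g x = p x)}"
  have "closedin pointwise_top ?T"
    unfolding closedin_pointwise_top_iff
  proof (intro allI impI CollectI)
    fix p and F :: "'a set"
    assume p: "\<forall>F. finite F \<longrightarrow> (\<exists>g\<in>?T. \<forall>x\<in>F. g x = p x)" and F: "finite F"
    then obtain t where t: "t \<in> ?T" "\<forall>x\<in>F. t x = p x" by blast
    with F obtain g where "g \<in> G" "\<forall>x\<in>F. g x = t x" by blast
    with t show "\<exists>g\<in>G. \<forall>x\<in>F. g x = p x" by auto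
  qed
  moreover have "G = ?T \<inter> Sym S" using R by blast
  ultimately show ?L unfolding sym_top_def closedin_subtopology by blast
qed

text \<open>Evaluation at \<open>x\<close> is continuous into a discrete space, where compact sets
  are finite.\<close>

lemma compactin_sym_top_finite_orbit:
  assumes "compactin (sym_top S) G"
  shows "finite ((\<lambda>g. g x) ` G)"
proof -
  have "compactin pointwise_top G"
    using assms by (simp add: sym_top_def compactin_subtopology)
  moreover have "continuous_map pointwise_top (discrete_topology UNIV) (\<lambda>g. g x)"
    unfolding pointwise_top_def by (rule continuous_map_product_projection) simp
  ultimately have "compactin (discrete_topology UNIV) ((\<lambda>g. g x) ` G)"
    by (rule image_compactin)
  then show ?thesis by (simp add: compactin_discrete_topology)
qed

text \<open>By Tychonoff the product of the finite orbits is compact, and it contains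
  \<open>G\<close>. What remains is that \<open>G\<close> is closed among all functions and not only
  within \<open>Sym S\<close>.\<close>

lemma compactin_sym_top_finite_orbits:
  assumes grp: "perm_group S G" and cl: "closedin (sym_top S) G"
    and fin: "\<And>x. x \<in> S \<Longrightarrow> finite ((\<lambda>g. g x) ` G)"
  shows "compactin (sym_top S) G"
proof -
  have GS: "g permutes S" if "g \<in> G" for g
    using grp that by (auto simp: perm_group_def Sym_def)
  define O' where "O' x = (\<lambda>g. g x) ` G" for x
  have finO: "finite (O' x)" for x
  proof (cases "x \<in> S")
    case False
    then have "O' x \<subseteq> {x}" using GS by (auto simp: O'_def permutes_def)
    then show ?thesis using finite_subset by blast
  qed (simp add: O'_def fin)
  have Oinv: "g ` O' x = O' x" if "g \<in> G" for g x
  proof (rule endo_inj_surj)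
    show "g ` O' x \<subseteq> O' x"
    proof
      fix z assume "z \<in> g ` O' x"
      then obtain h where "h \<in> G" "z = (g \<circ> h) x" by (auto simp: O'_def)
      moreover have "g \<circ> h \<in> G" using grp that \<open>h \<in> G\<close> by (auto simp: perm_group_def)
      ultimately show "z \<in> O' x" unfolding O'_def by blast
    qed
    show "inj_on g (O' x)" using GS[OF that] permutes_inj inj_on_subset by blast
  qed (rule finO)
  have self: "x \<in> O' x" for x
    using imageI[of id G "\<lambda>g. g x"] grp by (simp add: O'_def perm_group_def)
  \<comment> \<open>A pointwise limit of permutations may fail to be surjective in general. Here an
    approximation on the finite orbit of \<open>s\<close> permutes that orbit, so \<open>p\<close>
    also attains \<open>s\<close>.\<close>
  have "closedin pointwise_top G"
    unfolding closedin_pointwise_top_iff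
  proof (intro allI impI)
    fix p assume p: "\<forall>F. finite F \<longrightarrow> (\<exists>g\<in>G. \<forall>x\<in>F. g x = p x)"
    have "inj p"
    proof (rule injI)
      fix x y assume e: "p x = p y"
      obtain g where "g \<in> G" "\<forall>z\<in>{x,y}. g z = p z" using p by (meson finite.intros)
      with e GS[of g] show "x = y" by (metis insertCI permutes_inj injD)
    qed
    moreover have "surj p"
    proof (unfold surj_def, intro allI)
      fix s
      obtain g where g: "g \<in> G" "\<forall>z\<in>O' s. g z = p z" using p finO by meson
      have "s \<in> g ` O' s" using Oinv[OF g(1)] self by simp
      with g(2) show "\<exists>t. s = p t" by force
    qed
    moreover have "p x = x" if "x \<notin> S" for x
    proof -
      obtain g where "g \<in> G" "\<forall>z\<in>{x}. g z = p z" using p by (meson finite.intros)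
      with that GS[of g] show ?thesis by (auto simp: permutes_def)
    qed
    ultimately have "p \<in> Sym S"
      by (auto simp: Sym_def intro!: bij_moving_only_imp_permutes bijI)
    with p cl show "p \<in> G" by (simp add: closedin_sym_top_iff)
  qed
  moreover have "compactin pointwise_top (PiE UNIV O')"
    unfolding pointwise_top_def compactin_PiE
    by (auto simp: compactin_discrete_topology finO)
  moreover have "G \<subseteq> PiE UNIV O'" by (auto simp: O'_def PiE_def)
  ultimately have "compactin pointwise_top G" by (metis closed_compactin)
  then show ?thesis
    using grp by (simp add: sym_top_def compactin_subtopology perm_group_def)
qed

lemma perm_group_stab: "perm_group S G \<Longrightarrow> perm_group S (stab G x)"
  by (auto simp: perm_group_def stab_def Sym_def) (metis permutes_inverses(2) subsetD mem_Collect_eq)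

lemma closedin_sym_top_stab:
  assumes "closedin (sym_top S) G"
  shows "closedin (sym_top S) (stab G x)"
  unfolding closedin_sym_top_iff
proof (intro conjI ballI impI)
  show "stab G x \<subseteq> Sym S" using assms by (auto simp: closedin_sym_top_iff stab_def)
  fix p assume "p \<in> Sym S" and p: "\<forall>F. finite F \<longrightarrow> (\<exists>g\<in>stab G x. \<forall>x\<in>F. g x = p x)"
  then have "p \<in> G" using assms unfolding closedin_sym_top_iff stab_def by blast
  moreover obtain g where "g \<in> stab G x" "\<forall>z\<in>{x}. g z = p z"
    using p by (meson finite.intros)
  ultimately show "p \<in> stab G x" by (auto simp: stab_def)
qed

text \<open>The elements sending \<open>x\<close> to \<open>z\<close> are either absent or form a
  coset of \<open>stab G x\<close>, so their values at \<open>x'\<close> are a translate of a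
  stabiliser orbit.\<close>

lemma finite_coset_orbit:
  assumes grp: "perm_group S G" and fin: "finite ((\<lambda>g. g x') ` stab G x)"
  shows "finite {g x' | g. g \<in> G \<and> g x = z}"
proof (cases "\<exists>h\<in>G. h x = z")
  case True
  then obtain h where h: "h \<in> G" "h x = z" by blast
  have hS: "h permutes S" using grp h by (auto simp: perm_group_def Sym_def)
  have "{g x' | g. g \<in> G \<and> g x = z} \<subseteq> h ` (\<lambda>g. g x') ` stab G x"
  proof
    fix t assume "t \<in> {g x' | g. g \<in> G \<and> g x = z}"
    then obtain g where g: "g \<in> G" "g x = z" "t = g x'" by blast
    have "inv h \<circ> g \<in> stab G x"
      using grp g h hS by (auto simp: perm_group_def stab_def permutes_inverses permutes_inv_eq)
    moreover have "t = h ((inv h \<circ> g) x')" using g hS by (simp add: permutes_inverses)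
    ultimately show "t \<in> h ` (\<lambda>g. g x') ` stab G x" by blast
  qed
  then show ?thesis using fin finite_subset by blast
next
  case False
  then have "{g x' | g. g \<in> G \<and> g x = z} = {}" by blast
  then show ?thesis by (simp only: finite.emptyI)
qed

section \<open>Coloured trees\<close>

text \<open>A legal colouring is constant on the arcs into a vertex, so it amounts to a
  colouring \<open>col\<close> of the vertices.\<close>

locale coloured_tree =
  fixes X Y :: "'a set" and VX VY :: "'v set" and E :: "'v \<Rightarrow> 'v \<Rightarrow> bool" and col :: "'v \<Rightarrow> 'a"
  assumes E_sym: "E u w \<Longrightarrow> E w u"
    and side: "E u w \<Longrightarrow> (u \<in> VX \<and> w \<in> VY) \<or> (u \<in> VY \<and> w \<in> VX)"
    and disj: "VX \<inter> VY = {}"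
    and conn: "u \<in> VX \<union> VY \<Longrightarrow> w \<in> VX \<union> VY \<Longrightarrow> (u, w) \<in> (arcs E)\<^sup>*"
    and bridge: "E u w \<Longrightarrow> (u, w) \<notin> (arcs E - {(u, w), (w, u)})\<^sup>*"
    and colX: "v \<in> VX \<Longrightarrow> bij_betw col {w. E v w} X"
    and colY: "v \<in> VY \<Longrightarrow> bij_betw col {w. E v w} Y"
    and nonempty: "VX \<union> VY \<noteq> {}"
    and X2: "\<exists>a\<in>X. \<exists>b\<in>X. a \<noteq> b" and Y2: "\<exists>a\<in>Y. \<exists>b\<in>Y. a \<noteq> b"
    and XY: "X \<inter> Y = {}"
begin

lemma col_inj: "E v w \<Longrightarrow> E v w' \<Longrightarrow> col w = col w' \<Longrightarrow> w = w'"
  using side[of v w] colX[of v] colY[of v] unfolding bij_betw_def inj_on_def by blast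

lemma nbr_VX: "v \<in> VX \<Longrightarrow> E v w \<Longrightarrow> w \<in> VY" and nbr_VY: "v \<in> VY \<Longrightarrow> E v w \<Longrightarrow> w \<in> VX"
  using side[of v w] disj by blast+

lemma nbr_X:
  assumes "v \<in> VX" "x \<in> X"
  shows "\<exists>w. E v w \<and> w \<in> VY \<and> col w = x"
proof -
  have "x \<in> col ` {w. E v w}" using colX[OF assms(1)] assms(2) by (simp add: bij_betw_def)
  then show ?thesis using nbr_VX[OF assms(1)] by blast
qed

lemma nbr_Y:
  assumes "v \<in> VY" "y \<in> Y"
  shows "\<exists>w. E v w \<and> w \<in> VX \<and> col w = y"
proof -
  have "y \<in> col ` {w. E v w}" using colY[OF assms(1)] assms(2) by (simp add: bij_betw_def)
  then show ?thesis using nbr_VY[OF assms(1)] by blast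
qed

lemma VX_nonempty: "VX \<noteq> {}" and VY_nonempty: "VY \<noteq> {}"
proof -
  obtain a b where "a \<in> X" "b \<in> Y" using X2 Y2 by blast
  then show "VX \<noteq> {}" "VY \<noteq> {}" using nonempty nbr_X[of _ a] nbr_Y[of _ b] by auto
qed

lemma col_VX: assumes "v \<in> VX" shows "col v \<in> Y"
proof -
  obtain w where "E v w" "w \<in> VY" using nbr_X[OF assms] X2 by blast
  then show ?thesis using colY[of w] E_sym by (auto simp: bij_betw_def)
qed

lemma col_VY: assumes "v \<in> VY" shows "col v \<in> X"
proof -
  obtain w where "E v w" "w \<in> VX" using nbr_Y[OF assms] Y2 by blast
  then show ?thesis using colX[of w] E_sym by (auto simp: bij_betw_def)
qed

lemma two_nbrs:
  assumes "v \<in> VX"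
  shows "\<exists>a b. E v a \<and> E v b \<and> a \<noteq> b"
  using X2 nbr_X[OF assms] by metis

lemma other_nbr:
  assumes "v \<in> VX" shows "\<exists>z. E v z \<and> z \<noteq> y"
  using two_nbrs[OF assms] by metis

text \<open>Otherwise the four vertices form a 4-cycle, and three of its edges join the ends of the
  fourth, which is a bridge.\<close>

lemma common_nbr_unique:
  assumes "E u1 v" "E u1 v'" "E u2 v" "E u2 v'" "u1 \<noteq> u2"
  shows "v = v'"
proof (rule ccontr)
  assume "v \<noteq> v'"
  let ?A = "arcs E - {(u1, v), (v, u1)}"
  have "(u1, v') \<in> ?A" "(v', u2) \<in> ?A" "(u2, v) \<in> ?A"
    using assms \<open>v \<noteq> v'\<close> E_sym side[OF assms(1)] side[OF assms(2)] side[OF assms(3)] disj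
    by (auto simp: arcs_def)
  then have "(u1, v) \<in> ?A\<^sup>*" by (meson r_into_rtrancl rtrancl_trans)
  with bridge[OF assms(1)] show False by blast
qed

section \<open>Distance from a base vertex and uniqueness of parents\<close>

definition depth :: "'v \<Rightarrow> 'v \<Rightarrow> nat" where
  "depth v w = (LEAST n. (v, w) \<in> arcs E ^^ n)"

lemma depth_walk:
  assumes "v \<in> VX \<union> VY" "w \<in> VX \<union> VY"
  shows "(v, w) \<in> arcs E ^^ depth v w"
  unfolding depth_def using conn[OF assms] rtrancl_imp_relpow LeastI_ex by metis

lemma depth_le: "(v, w) \<in> arcs E ^^ n \<Longrightarrow> depth v w \<le> n"
  unfolding depth_def by (rule Least_le)

lemma depth_edge:
  assumes "v \<in> VX \<union> VY" "E u w"
  shows "depth v w \<le> Suc (depth v u)"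
proof (rule depth_le)
  have "(v, u) \<in> arcs E ^^ depth v u" using assms side depth_walk by blast
  with assms(2) show "(v, w) \<in> arcs E ^^ Suc (depth v u)" by (auto simp: arcs_def)
qed

lemma walk_parity:
  assumes "v \<in> VX \<union> VY"
  shows "(v, w) \<in> arcs E ^^ n \<Longrightarrow> w \<in> VX \<union> VY \<and> ((w \<in> VX \<longleftrightarrow> v \<in> VX) \<longleftrightarrow> even n)"
proof (induction n arbitrary: w)
  case (Suc n)
  then obtain u where u: "(v, u) \<in> arcs E ^^ n" "E u w" by (auto simp: arcs_def)
  then show ?case using Suc.IH[OF u(1)] side[OF u(2)] disj by auto
qed (use assms in auto)

text \<open>Every arc switches sides of the bipartition, so the distances of adjacent vertices from
  \<open>v\<close> have different parity.\<close>

lemma depth_edge_neq: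
  assumes "v \<in> VX \<union> VY" "E u w"
  shows "depth v u \<noteq> depth v w"
proof
  assume e: "depth v u = depth v w"
  have "(v, u) \<in> arcs E ^^ depth v u" "(v, w) \<in> arcs E ^^ depth v w"
    using assms side depth_walk by blast+
  then have "u \<in> VX \<longleftrightarrow> w \<in> VX" using walk_parity[OF assms(1)] e by metis
  with side[OF assms(2)] disj show False by blast
qed

lemma depth_self [simp]: "depth v v = 0"
  using depth_le[of v v 0] by simp

lemma depth_parent:
  assumes "v \<in> VX \<union> VY" "w \<in> VX \<union> VY" "depth v w = Suc n"
  shows "\<exists>u. E u w \<and> depth v u = n"
proof -
  have "(v, w) \<in> arcs E ^^ Suc n" using depth_walk[OF assms(1,2)] assms(3) by simp
  then obtain u where u: "(v, u) \<in> arcs E ^^ n" "E u w" by (auto simp: arcs_def)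
  have "depth v u \<le> n" using depth_le u by blast
  moreover have "depth v w \<le> Suc (depth v u)" using depth_edge assms(1) u by blast
  ultimately show ?thesis using u assms(3) by force
qed

lemma depth_zero: "v \<in> VX \<union> VY \<Longrightarrow> w \<in> VX \<union> VY \<Longrightarrow> depth v w = 0 \<Longrightarrow> w = v"
  using depth_walk[of v w] by simp

text \<open>Stepping to a parent lowers the depth, so the descent from \<open>u\<close> to
  \<open>v\<close> stays below the bound. The bound serves to keep such walks away from deeper
  vertices.\<close>

lemma walk_within_depth:
  assumes "v \<in> VX \<union> VY"
  shows "u \<in> VX \<union> VY \<Longrightarrow> depth v u \<le> n \<Longrightarrow>
    (u, v) \<in> {(a, b). E a b \<and> depth v a \<le> n \<and> depth v b \<le> n}\<^sup>*"
proof (induction "depth v u" arbitrary: u)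
  case 0
  then show ?case using depth_zero[OF assms, of u] by simp
next
  case (Suc k)
  then obtain t where t: "E t u" "depth v t = k" using depth_parent[OF assms] by metis
  have "(t, v) \<in> {(a, b). E a b \<and> depth v a \<le> n \<and> depth v b \<le> n}\<^sup>*"
    using Suc t side by (intro Suc.hyps) auto
  moreover have "(u, t) \<in> {(a, b). E a b \<and> depth v a \<le> n \<and> depth v b \<le> n}"
    using Suc t E_sym by auto
  ultimately show ?case by (rule converse_rtrancl_into_rtrancl[rotated])
qed

text \<open>Both parents reach \<open>v\<close> by walks that are too shallow to meet
  \<open>w\<close>. With a second parent, the walk from \<open>w\<close> through \<open>u2\<close>
  and \<open>v\<close> to \<open>u1\<close> would bypass the bridge between \<open>w\<close> and
  \<open>u1\<close>.\<close>

lemma parent_unique: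
  assumes v: "v \<in> VX \<union> VY" and E: "E u1 w" "E u2 w"
    and d: "depth v w = Suc (depth v u1)" "depth v w = Suc (depth v u2)"
  shows "u1 = u2"
proof (rule ccontr)
  assume ne: "u1 \<noteq> u2"
  let ?n = "depth v u1"
  let ?R = "{(a, b). E a b \<and> depth v a \<le> ?n \<and> depth v b \<le> ?n}"
  let ?A = "arcs E - {(w, u1), (u1, w)}"
  have V: "u1 \<in> VX \<union> VY" "u2 \<in> VX \<union> VY" using E side by blast+
  have sub: "?R \<subseteq> ?A" using d by (auto simp: arcs_def)
  have symR: "sym (?R\<^sup>*)" by (intro sym_rtrancl) (auto simp: sym_def E_sym)
  have "(u1, v) \<in> ?R\<^sup>*" by (rule walk_within_depth[OF v V(1)]) simp
  then have "(v, u1) \<in> ?R\<^sup>*" using symR by (rule symD[rotated])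
  moreover have "(u2, v) \<in> ?R\<^sup>*" by (rule walk_within_depth[OF v V(2)]) (use d in simp)
  ultimately have "(u2, u1) \<in> ?A\<^sup>*" using rtrancl_mono[OF sub] by (meson rtrancl_trans subsetD)
  moreover have "(w, u2) \<in> ?A" using E ne E_sym side disj by (auto simp: arcs_def)
  ultimately have "(w, u1) \<in> ?A\<^sup>*" by (rule converse_rtrancl_into_rtrancl[rotated])
  with bridge[OF E_sym[OF E(1)]] show False by blast
qed

section \<open>Tree maps with a prescribed recolouring\<close>

text \<open>The map is built outwards from \<open>v\<close>: a vertex \<open>w\<close> goes to the
  neighbour of the image of its parent that has colour \<open>\<sigma> (col w)\<close>. The base
  vertex stays in place, hence the condition on \<open>col v\<close>.\<close>

lemma exists_recolouring_map:
  assumes v: "v \<in> VX \<union> VY" and sX: "\<And>x. x \<in> X \<Longrightarrow> \<sigma> x \<in> X" and sY: "\<And>y. y \<in> Y \<Longrightarrow> \<sigma> y \<in> Y"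
    and sv: "\<sigma> (col v) = col v"
  shows "\<exists>g. g v = v \<and> (\<forall>u w. E u w \<longrightarrow> E (g u) (g w)) \<and>
    (\<forall>w\<in>VX. g w \<in> VX) \<and> (\<forall>w\<in>VY. g w \<in> VY) \<and> (\<forall>w\<in>VX \<union> VY. col (g w) = \<sigma> (col w))"
proof -
  define par where "par w = (SOME u. E u w \<and> depth v w = Suc (depth v u))" for w
  define nb where "nb u x = (SOME w. E u w \<and> col w = x)" for u x
  \<comment> \<open>Recursion on the depth: \<open>G n\<close> is meaningful only at vertices of
    depth \<open>n\<close>, and \<open>g\<close> reads each vertex at its own stage.\<close>
  define G where "G = rec_nat (\<lambda>_. v) (\<lambda>n f w. nb (f (par w)) (\<sigma> (col w)))"
  have G_Suc: "G (Suc n) w = nb (G n (par w)) (\<sigma> (col w))" for n w by (simp add: G_def)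
  define g where "g w = G (depth v w) w" for w
  have gv: "g v = v" by (simp add: g_def G_def)
  have par: "par w = u" if "E u w" "depth v w = Suc (depth v u)" for u w
    using someI[of "\<lambda>u. E u w \<and> depth v w = Suc (depth v u)" u] that parent_unique[OF v]
    unfolding par_def by blast
  have step: "g w = nb (g u) (\<sigma> (col w))" if "E u w" "depth v w = Suc (depth v u)" for u w
    using par[OF that] that G_Suc[of "depth v u" w] by (simp add: g_def)
  have nb: "E u (nb u x) \<and> col (nb u x) = x" if "u \<in> VX \<and> x \<in> X \<or> u \<in> VY \<and> x \<in> Y" for u x
    unfolding nb_def by (rule someI_ex) (use that nbr_X nbr_Y in blast)
  have nbr: "E (g u) (g w) \<and> col (g w) = \<sigma> (col w)"
    if "E u w" "depth v w = Suc (depth v u)" "(u \<in> VX \<longleftrightarrow> g u \<in> VX) \<and> (u \<in> VY \<longleftrightarrow> g u \<in> VY)" for u w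
  proof -
    have "g u \<in> VX \<and> \<sigma> (col w) \<in> X \<or> g u \<in> VY \<and> \<sigma> (col w) \<in> Y"
      using that side[of u w] col_VX col_VY sX sY by blast
    then show ?thesis using step[OF that(1,2)] nb by simp
  qed
  \<comment> \<open>Preservation of sides belongs to the induction, since it ensures that the wanted
    colour occurs among the neighbours of \<open>g u\<close>.\<close>
  have inv: "((w \<in> VX \<longleftrightarrow> g w \<in> VX) \<and> (w \<in> VY \<longleftrightarrow> g w \<in> VY)) \<and> col (g w) = \<sigma> (col w)"
    if "w \<in> VX \<union> VY" for w
    using that
  proof (induction "depth v w" arbitrary: w)
    case 0
    then have "w = v" using depth_zero[OF v] by simp
    then show ?case using gv sv by simp
  next
    case (Suc k)
    then obtain u where u: "E u w" "depth v u = k" using depth_parent[OF v] by metis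
    have IH: "(u \<in> VX \<longleftrightarrow> g u \<in> VX) \<and> (u \<in> VY \<longleftrightarrow> g u \<in> VY)"
      using Suc.hyps(1)[of u] u side by blast
    have "E (g u) (g w) \<and> col (g w) = \<sigma> (col w)"
      using nbr[OF u(1) _ IH] Suc(2) u(2) by simp
    then show ?case using IH side[OF u(1)] side[of "g u" "g w"] disj by blast
  qed
  have "E (g u) (g w)" if "E u w" for u w
  proof -
    have V: "u \<in> VX \<union> VY" "w \<in> VX \<union> VY" using that side by blast+
    \<comment> \<open>Every edge joins a parent to a child in one of the two orders, so
      \<open>nbr\<close> covers all edges.\<close>
    have "depth v w = Suc (depth v u) \<or> depth v u = Suc (depth v w)"
      using depth_edge[OF v that] depth_edge[OF v E_sym[OF that]] depth_edge_neq[OF v that] by linarith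
    then show ?thesis
      using nbr[OF that] nbr[OF E_sym[OF that]] inv[OF V(1)] inv[OF V(2)] E_sym by blast
  qed
  with gv inv show ?thesis by blast
qed

text \<open>Neighbours of a vertex are told apart by their colours, so being fixed propagates along
  walks from \<open>v\<close>.\<close>

lemma recolouring_map_identity:
  assumes "h v = v" "v \<in> VX \<union> VY" and hE: "\<And>u w. E u w \<Longrightarrow> E (h u) (h w)"
    and hc: "\<And>w. w \<in> VX \<union> VY \<Longrightarrow> col (h w) = col w" and "w \<in> VX \<union> VY"
  shows "h w = w"
  using conn[OF assms(2,5)]
proof (induction rule: rtrancl_induct)
  case (step y z)
  then have "E y z" by (simp add: arcs_def)
  then show ?case using hE[of y z] step.IH hc[of z] side col_inj by (metis UnCI)
qed (fact assms(1))

text \<open>This is \<open>U_c\<close> in terms of vertex colours: the local action is not named,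
  but some element of the local group must induce the same recolouring of the neighbours.\<close>

definition U :: "('a \<Rightarrow> 'a) set \<Rightarrow> ('a \<Rightarrow> 'a) set \<Rightarrow> ('v \<Rightarrow> 'v) set" where
  "U M N = {g. g permutes (VX \<union> VY) \<and> (\<forall>u w. E (g u) (g w) \<longleftrightarrow> E u w) \<and> g ` VX = VX \<and>
     (\<forall>v\<in>VX. \<exists>m\<in>M. \<forall>w. E v w \<longrightarrow> col (g w) = m (col w)) \<and>
     (\<forall>v\<in>VY. \<exists>n\<in>N. \<forall>w. E v w \<longrightarrow> col (g w) = n (col w))}"

text \<open>The maps for \<open>\<sigma>\<close> and \<open>inv \<sigma>\<close> are mutually inverse, because a colour-preserving
  edge-preserving map with a fixed vertex is the identity.\<close>

lemma exists_recolouring_automorphism: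
  assumes v: "v \<in> VX \<union> VY" and \<sigma>: "bij \<sigma>" "\<sigma> ` X = X" "\<sigma> ` Y = Y" "\<sigma> (col v) = col v"
    and M: "\<exists>m\<in>M. \<forall>x\<in>X. m x = \<sigma> x" and N: "\<exists>n\<in>N. \<forall>y\<in>Y. n y = \<sigma> y"
  shows "\<exists>g\<in>U M N. g v = v \<and> (\<forall>w\<in>VX \<union> VY. col (g w) = \<sigma> (col w))"
proof -
  let ?V = "VX \<union> VY"
  have inv\<sigma>: "inv \<sigma> (\<sigma> x) = x" "\<sigma> (inv \<sigma> x) = x" for x
    using \<sigma>(1) by (auto simp: bij_is_inj bij_is_surj surj_f_inv_f)
  have s\<sigma>: "\<And>x. x \<in> X \<Longrightarrow> \<sigma> x \<in> X" "\<And>x. x \<in> Y \<Longrightarrow> \<sigma> x \<in> Y" using \<sigma>(2,3) by blast+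
  obtain g where g: "g v = v" "\<And>u w. E u w \<Longrightarrow> E (g u) (g w)" "\<And>w. w \<in> VX \<Longrightarrow> g w \<in> VX"
    "\<And>w. w \<in> VY \<Longrightarrow> g w \<in> VY" "\<And>w. w \<in> ?V \<Longrightarrow> col (g w) = \<sigma> (col w)"
    using exists_recolouring_map[of v \<sigma>, OF v s\<sigma> \<sigma>(4)] by blast
  have "inv \<sigma> x \<in> X" if "x \<in> X" for x using that \<sigma>(2) inv\<sigma>(1) by (metis imageE)
  moreover have "inv \<sigma> x \<in> Y" if "x \<in> Y" for x using that \<sigma>(3) inv\<sigma>(1) by (metis imageE)
  moreover have "inv \<sigma> (col v) = col v" using \<sigma>(4) inv\<sigma>(1) by metis
  ultimately have "\<exists>h. h v = v \<and> (\<forall>u w. E u w \<longrightarrow> E (h u) (h w)) \<and> (\<forall>w\<in>VX. h w \<in> VX) \<and>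
      (\<forall>w\<in>VY. h w \<in> VY) \<and> (\<forall>w\<in>?V. col (h w) = inv \<sigma> (col w))"
    by (rule exists_recolouring_map[OF v])
  then obtain h where h: "h v = v" "\<And>u w. E u w \<Longrightarrow> E (h u) (h w)" "\<And>w. w \<in> VX \<Longrightarrow> h w \<in> VX"
    "\<And>w. w \<in> VY \<Longrightarrow> h w \<in> VY" "\<And>w. w \<in> ?V \<Longrightarrow> col (h w) = inv \<sigma> (col w)"
    by blast
  have hg: "h (g w) = w" if "w \<in> ?V" for w
  proof (rule recolouring_map_identity[of "\<lambda>w. h (g w)", OF _ v _ _ that])
    fix w assume w: "w \<in> ?V"
    then have "g w \<in> ?V" using g(3,4) by blast
    then show "col (h (g w)) = col w" using g(5) h(5) w inv\<sigma>(1) by simp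
  qed (use g(1,2) h(1,2) in auto)
  have gh: "g (h w) = w" if "w \<in> ?V" for w
  proof (rule recolouring_map_identity[of "\<lambda>w. g (h w)", OF _ v _ _ that])
    fix w assume w: "w \<in> ?V"
    then have "h w \<in> ?V" using h(3,4) by blast
    then show "col (g (h w)) = col w" using g(5) h(5) w inv\<sigma>(2) by simp
  qed (use g(1,2) h(1,2) in auto)
  \<comment> \<open>The map \<open>g\<close> is controlled only on the tree; a permutation of
    \<open>VX \<union> VY\<close> must also fix every point outside.\<close>
  define k where "k w = (if w \<in> ?V then g w else w)" for w
  have kV: "k w = g w" if "w \<in> ?V" for w using that by (simp add: k_def)
  have EV: "u \<in> ?V \<and> w \<in> ?V" if "E u w" for u w using side that by blast
  have "bij_betw k ?V ?V"
    by (rule bij_betw_byWitness[where f' = h]) (use g h hg gh kV in auto)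
  then have "k permutes ?V" by (rule bij_imp_permutes) (auto simp: k_def)
  moreover have "E (k u) (k w) \<longleftrightarrow> E u w" for u w
  proof
    assume e: "E (k u) (k w)"
    then have "u \<in> ?V" "w \<in> ?V" using EV[OF e] by (auto simp: k_def split: if_splits)
    then show "E u w" using h(2)[OF e] hg kV by simp
  next
    assume "E u w" then show "E (k u) (k w)" using EV kV g(2) by simp
  qed
  moreover have "k ` VX = VX"
    using kV g(3) h(3) gh by (auto simp: image_iff) (metis UnCI)
  moreover have "\<exists>m\<in>M. \<forall>w. E x w \<longrightarrow> col (k w) = m (col w)" if "x \<in> VX" for x
  proof -
    obtain m where "m \<in> M" "\<forall>x\<in>X. m x = \<sigma> x" using M by blast
    then show ?thesis using nbr_VX[OF that] kV g(5) col_VY by (intro bexI[of _ m]) auto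
  qed
  moreover have "\<exists>n\<in>N. \<forall>w. E y w \<longrightarrow> col (k w) = n (col w)" if "y \<in> VY" for y
  proof -
    obtain n where "n \<in> N" "\<forall>x\<in>Y. n x = \<sigma> x" using N by blast
    then show ?thesis using nbr_VY[OF that] kV g(5) col_VX by (intro bexI[of _ n]) auto
  qed
  ultimately have "k \<in> U M N" unfolding U_def by blast
  then show ?thesis using g(1,5) kV v by (intro bexI[of _ k]) auto
qed

section \<open>Group structure of \<open>U M N\<close> and its action on \<open>VY\<close>\<close>

lemma U_permutes: "g \<in> U M N \<Longrightarrow> g permutes (VX \<union> VY)"
  and U_E: "g \<in> U M N \<Longrightarrow> E (g u) (g w) \<longleftrightarrow> E u w"
  and U_colX: "g \<in> U M N \<Longrightarrow> v \<in> VX \<Longrightarrow> \<exists>m\<in>M. \<forall>w. E v w \<longrightarrow> col (g w) = m (col w)"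
  and U_colY: "g \<in> U M N \<Longrightarrow> v \<in> VY \<Longrightarrow> \<exists>n\<in>N. \<forall>w. E v w \<longrightarrow> col (g w) = n (col w)"
  by (simp_all add: U_def)

lemma image_VY:
  assumes "g permutes (VX \<union> VY)" "g ` VX = VX"
  shows "g ` VY = VY"
proof -
  have "VY = (VX \<union> VY) - VX" using disj by blast
  then have "g ` VY = g ` (VX \<union> VY) - g ` VX"
    by (metis assms(1) permutes_inj image_set_diff)
  also have "\<dots> = VY" using permutes_image[OF assms(1)] assms(2) disj by auto
  finally show ?thesis .
qed

lemma U_VX: "g \<in> U M N \<Longrightarrow> v \<in> VX \<Longrightarrow> g v \<in> VX"
  by (auto simp: U_def)

lemma U_VY: "g \<in> U M N \<Longrightarrow> v \<in> VY \<Longrightarrow> g v \<in> VY"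
  using image_VY by (auto simp: U_def)

lemma U_id: assumes "id \<in> M" "id \<in> N" shows "id \<in> U M N"
  using assms by (auto simp: U_def permutes_id intro!: bexI[of _ id])

text \<open>Local actions form a cocycle: at \<open>v\<close>, that of \<open>g \<circ> h\<close> is
  that of \<open>g\<close> at \<open>h v\<close> after that of \<open>h\<close> at
  \<open>v\<close>.\<close>

lemma U_comp:
  assumes M: "perm_group X M" and N: "perm_group Y N" and g: "g \<in> U M N" and h: "h \<in> U M N"
  shows "g \<circ> h \<in> U M N"
proof -
  have "\<exists>m\<in>M. \<forall>w. E v w \<longrightarrow> col ((g \<circ> h) w) = m (col w)" if v: "v \<in> VX" for v
  proof -
    obtain m where m: "m \<in> M" "\<forall>w. E v w \<longrightarrow> col (h w) = m (col w)" using U_colX[OF h v] by blast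
    obtain m' where m': "m' \<in> M" "\<forall>w. E (h v) w \<longrightarrow> col (g w) = m' (col w)"
      using U_colX[OF g U_VX[OF h v]] by blast
    have "m' \<circ> m \<in> M" using M m m' by (auto simp: perm_group_def)
    then show ?thesis using m m' U_E[OF h] by (intro bexI[of _ "m' \<circ> m"]) auto
  qed
  moreover have "\<exists>m\<in>N. \<forall>w. E v w \<longrightarrow> col ((g \<circ> h) w) = m (col w)" if v: "v \<in> VY" for v
  proof -
    obtain m where m: "m \<in> N" "\<forall>w. E v w \<longrightarrow> col (h w) = m (col w)" using U_colY[OF h v] by blast
    obtain m' where m': "m' \<in> N" "\<forall>w. E (h v) w \<longrightarrow> col (g w) = m' (col w)"
      using U_colY[OF g U_VY[OF h v]] by blast
    have "m' \<circ> m \<in> N" using N m m' by (auto simp: perm_group_def)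
    then show ?thesis using m m' U_E[OF h] by (intro bexI[of _ "m' \<circ> m"]) auto
  qed
  moreover have "g \<circ> h permutes (VX \<union> VY)" using g h U_permutes permutes_compose by blast
  moreover have "(g \<circ> h) ` VX = VX"
  proof -
    have "g ` VX = VX" "h ` VX = VX" using g h by (auto simp: U_def)
    then show ?thesis by (metis image_comp)
  qed
  ultimately show ?thesis using U_E[OF g] U_E[OF h] by (simp add: U_def)
qed

text \<open>The local action of \<open>inv g\<close> at \<open>v\<close> is the inverse of the local
  action of \<open>g\<close> at \<open>inv g v\<close>.\<close>

lemma U_inv:
  assumes M: "perm_group X M" and N: "perm_group Y N" and g: "g \<in> U M N"
  shows "inv g \<in> U M N"
proof -
  have p: "g permutes (VX \<union> VY)" using U_permutes g .
  have gi: "g (inv g w) = w" "inv g (g w) = w" for w using permutes_inverses[OF p] by auto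
  have E: "E (inv g u) (inv g w) \<longleftrightarrow> E u w" for u w using U_E[OF g, of "inv g u" "inv g w"] gi by simp
  have iX: "inv g ` VX = VX"
  proof -
    have "inv g ` g ` VX = VX" using gi by (simp add: image_image)
    moreover have "g ` VX = VX" using g by (simp add: U_def)
    ultimately show ?thesis by simp
  qed
  have ip: "inv g permutes (VX \<union> VY)" using permutes_inv[OF p] .
  have iY: "inv g ` VY = VY" using image_VY[OF ip iX] .
  have "\<exists>m\<in>M. \<forall>w. E v w \<longrightarrow> col (inv g w) = m (col w)" if "v \<in> VX" for v
  proof -
    have "inv g v \<in> VX" using iX that by blast
    then obtain m where m: "m \<in> M" "\<forall>w. E (inv g v) w \<longrightarrow> col (g w) = m (col w)"
      using U_colX[OF g] by blast
    have mp: "m permutes X" "inv m \<in> M" using M m by (auto simp: perm_group_def Sym_def)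
    have "col (inv g w) = inv m (col w)" if "E v w" for w
      using m(2)[rule_format, of "inv g w"] that E gi permutes_inverses(2)[OF mp(1)] by metis
    then show ?thesis using mp by blast
  qed
  moreover have "\<exists>m\<in>N. \<forall>w. E v w \<longrightarrow> col (inv g w) = m (col w)" if "v \<in> VY" for v
  proof -
    have "inv g v \<in> VY" using iY that by blast
    then obtain m where m: "m \<in> N" "\<forall>w. E (inv g v) w \<longrightarrow> col (g w) = m (col w)"
      using U_colY[OF g] by blast
    have mp: "m permutes Y" "inv m \<in> N" using N m by (auto simp: perm_group_def Sym_def)
    have "col (inv g w) = inv m (col w)" if "E v w" for w
      using m(2)[rule_format, of "inv g w"] that E gi permutes_inverses(2)[OF mp(1)] by metis
    then show ?thesis using mp by blast
  qed
  ultimately show ?thesis using ip iX E by (simp add: U_def)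
qed

text \<open>The image of \<open>U M N\<close> under this map is the box product.\<close>

definition restr :: "('v \<Rightarrow> 'v) \<Rightarrow> 'v \<Rightarrow> 'v" where
  "restr g = (\<lambda>y. if y \<in> VY then g y else y)"

lemma restr_permutes: assumes "g \<in> U M N" shows "restr g permutes VY"
proof (rule bij_imp_permutes)
  have "g permutes (VX \<union> VY)" "g ` VX = VX" using assms by (auto simp: U_def)
  then have "bij_betw g VY VY"
    using image_VY permutes_inj by (metis bij_betw_def inj_on_subset subset_UNIV)
  then show "bij_betw (restr g) VY VY"
    by (rule bij_betw_cong[THEN iffD1, rotated]) (simp add: restr_def)
qed (simp add: restr_def)

lemma restr_comp: "h \<in> U M N \<Longrightarrow> restr g \<circ> restr h = restr (g \<circ> h)"
  using U_VY by (auto simp: restr_def fun_eq_iff)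

lemma perm_group_restr_U:
  assumes M: "perm_group X M" and N: "perm_group Y N"
  shows "perm_group VY (restr ` U M N)"
  unfolding perm_group_def
proof (intro conjI ballI)
  show "restr ` U M N \<subseteq> Sym VY" using restr_permutes by (auto simp: Sym_def)
  have idU: "id \<in> U M N" using U_id M N by (simp add: perm_group_def)
  have ridd: "restr id = id" by (auto simp: restr_def)
  show "id \<in> restr ` U M N" using idU ridd by force
  fix a assume "a \<in> restr ` U M N"
  then obtain g where g: "g \<in> U M N" "a = restr g" by blast
  {
    fix b assume "b \<in> restr ` U M N"
    then show "a \<circ> b \<in> restr ` U M N" using g U_comp[OF M N] restr_comp by force
  }
  have gi: "inv g \<in> U M N" using U_inv[OF M N g(1)] .
  have "restr (inv g) \<circ> restr g = id"
    using restr_comp[OF g(1), of "inv g"] U_permutes[OF g(1)] ridd by (simp add: permutes_inv_o)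
  moreover have "restr g \<circ> restr (inv g) = id"
    using restr_comp[OF gi, of g] U_permutes[OF g(1)] ridd by (simp add: permutes_inv_o)
  ultimately have "inv (restr g) = restr (inv g)" by (metis inv_unique_comp)
  with g gi show "inv a \<in> restr ` U M N" by blast
qed

section \<open>Closedness of the box product\<close>

text \<open>Finitely many colours at \<open>v\<close> correspond to finitely many neighbours, where
  \<open>q\<close> agrees with some \<open>g\<close> having a local element in \<open>K\<close>. So
  the local action of \<open>q\<close> is a limit of elements of \<open>K\<close>, and
  \<open>K\<close> is closed.\<close>

lemma local_limit:
  assumes q: "bij q" "\<And>u w. E (q u) (q w) \<longleftrightarrow> E u w"
    and b: "bij_betw col {w. E v w} S" "bij_betw col {w. E (q v) w} S"
    and K: "closedin (sym_top S) K"
    and lim: "\<And>F. finite F \<Longrightarrow>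
      \<exists>g. (\<forall>x\<in>F. g x = q x) \<and> (\<exists>m\<in>K. \<forall>w. E v w \<longrightarrow> col (g w) = m (col w))"
  shows "\<exists>m\<in>K. \<forall>w. E v w \<longrightarrow> col (q w) = m (col w)"
proof -
  define nb where "nb = inv_into {w. E v w} col"
  have nb: "bij_betw nb S {w. E v w}" unfolding nb_def using b(1) by (rule bij_betw_inv_into)
  have nbc: "nb (col w) = w" if "E v w" for w
    using that b(1) by (simp add: nb_def bij_betw_def)
  have cnb: "col (nb x) = x" if "x \<in> S" for x
    using that b(1) by (metis nb_def bij_betw_inv_into_right)
  have nbE: "E v (nb x)" if "x \<in> S" for x using nb that by (auto simp: bij_betw_def)
  have "q ` {w. E v w} = {w. E (q v) w}"
    using q bij_is_surj[OF q(1)] by (auto simp: image_iff) (metis surjD)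
  then have "bij_betw q {w. E v w} {w. E (q v) w}"
    using bij_is_inj[OF q(1)] by (metis bij_betw_def inj_on_subset subset_UNIV)
  then have bb: "bij_betw (col \<circ> (q \<circ> nb)) S S"
    using nb b(2) bij_betw_trans by metis
  \<comment> \<open>The local action of \<open>q\<close> at \<open>v\<close>, completed by the
    identity so that it lies in \<open>Sym S\<close> and agrees with every element of
    \<open>K\<close> off \<open>S\<close>.\<close>
  define p where "p x = (if x \<in> S then col (q (nb x)) else x)" for x
  have "bij_betw p S S" using bb by (rule bij_betw_cong[THEN iffD1, rotated]) (simp add: p_def)
  then have pS: "p \<in> Sym S"
    unfolding Sym_def by (intro CollectI bij_imp_permutes) (auto simp: p_def)
  have KS: "m permutes S" if "m \<in> K" for m
    using K that by (auto simp: closedin_sym_top_iff Sym_def)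
  have "\<exists>m\<in>K. \<forall>x\<in>F. m x = p x" if F: "finite F" for F
  proof -
    obtain g m where g: "\<forall>x\<in>nb ` (F \<inter> S). g x = q x" "m \<in> K"
      "\<forall>w. E v w \<longrightarrow> col (g w) = m (col w)"
      using lim[of "nb ` (F \<inter> S)"] F by auto
    have "m x = p x" if "x \<in> F" for x
      using g that nbE cnb KS[OF g(2)] by (cases "x \<in> S") (auto simp: p_def permutes_def, metis IntI imageI)
    with g show ?thesis by blast
  qed
  then have "p \<in> K" using K pS by (simp add: closedin_sym_top_iff)
  moreover have "col (q w) = p (col w)" if "E v w" for w
    using that nbc b(1) by (auto simp: p_def bij_betw_def)
  ultimately show ?thesis by blast
qed

text \<open>A vertex of \<open>VX\<close> is the only common neighbour of any two of its neighbours, so a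
  pointwise limit on \<open>VY\<close> determines its extension to \<open>VX\<close>.\<close>

lemma closedin_restr_U:
  assumes M: "closedin (sym_top X) M" and N: "closedin (sym_top Y) N"
  shows "closedin (sym_top VY) (restr ` U M N)"
  unfolding closedin_sym_top_iff
proof (intro conjI ballI impI)
  show "restr ` U M N \<subseteq> Sym VY" using restr_permutes by (auto simp: Sym_def)
  fix p assume "p \<in> Sym VY"
    and lim: "\<forall>F. finite F \<longrightarrow> (\<exists>g\<in>restr ` U M N. \<forall>x\<in>F. g x = p x)"
  then have p: "p permutes VY" by (simp add: Sym_def)
  have "\<forall>v. \<exists>a b. v \<in> VX \<longrightarrow> E v a \<and> E v b \<and> a \<noteq> b" using two_nbrs by blast
  then obtain a b where ab: "\<And>v. v \<in> VX \<Longrightarrow> E v (a v) \<and> E v (b v) \<and> a v \<noteq> b v" by metis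
  have abY: "a v \<in> VY" "b v \<in> VY" if "v \<in> VX" for v using ab[OF that] nbr_VX[OF that] by auto
  define q where "q v = (if v \<in> VX then THE t. E t (p (a v)) \<and> E t (p (b v)) else p v)" for v
  \<comment> \<open>An element of \<open>U M N\<close> with the right values at the two chosen
    neighbours of \<open>v\<close> witnesses that the \<open>THE\<close> in \<open>q v\<close> is
    well defined.\<close>
  have qg: "q v = g v" if v: "v \<in> VX" and g: "g \<in> U M N" "g (a v) = p (a v)" "g (b v) = p (b v)" for v g
  proof -
    have 1: "E (g v) (p (a v)) \<and> E (g v) (p (b v))" using ab[OF v] g U_E[OF g(1)] by metis
    have "p (a v) \<noteq> p (b v)" using ab[OF v] permutes_inj[OF p] by (metis injD)
    then have "(THE t. E t (p (a v)) \<and> E t (p (b v))) = g v"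
      using 1 common_nbr_unique E_sym by (intro the_equality) blast+
    then show ?thesis using v by (simp add: q_def)
  qed
  have approx: "\<exists>g\<in>U M N. \<forall>x\<in>F. g x = q x" if "finite F" for F
  proof -
    \<comment> \<open>Adding the chosen neighbours to \<open>F\<close> turns an approximation of
      \<open>p\<close> on \<open>VY\<close> into an approximation of \<open>q\<close> on all of
      \<open>F\<close>.\<close>
    have "finite (F \<union> a ` F \<union> b ` F)" using that by simp
    with lim[THEN spec, of "F \<union> a ` F \<union> b ` F"]
    obtain g where g: "g \<in> U M N" "\<forall>x\<in>F \<union> a ` F \<union> b ` F. restr g x = p x" by auto
    have "g x = q x" if "x \<in> F" for x
    proof (cases "x \<in> VX")
      case True
      then have "restr g (a x) = g (a x)" "restr g (b x) = g (b x)" using abY by (simp_all add: restr_def)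
      then show ?thesis using qg[OF True g(1)] g(2) that by simp
    next
      case False
      have "restr g x = g x" using False permutes_not_in[OF U_permutes[OF g(1)], of x]
        by (auto simp: restr_def)
      then show ?thesis using g(2) that False by (simp add: q_def)
    qed
    with g show ?thesis by blast
  qed
  \<comment> \<open>Injectivity and adjacency involve two vertices at a time and so pass to the
    limit; surjectivity needs a separate argument.\<close>
  have approx2: "\<exists>g\<in>U M N. g x = q x \<and> g y = q y" for x y
    using approx[of "{x,y}"] by auto
  have inj: "inj q"
    by (rule injI) (metis approx2 U_permutes permutes_inj injD)
  have qE: "E (q u) (q w) \<longleftrightarrow> E u w" for u w using approx2[of u w] U_E by metis
  have qVX: "q v \<in> VX" if "v \<in> VX" for v using approx2[of v v] U_VX that by metis
  have surjX: "\<exists>t\<in>VX. q t = v" if v: "v \<in> VX" for v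
  proof -
    \<comment> \<open>The chosen neighbours of \<open>v\<close> are pulled back through
      \<open>p\<close> to \<open>y\<close> and \<open>z\<close>. An approximation exact at both
      yields a common neighbour \<open>t\<close> of \<open>y\<close> and \<open>z\<close>, and
      \<open>q t\<close> must then be \<open>v\<close>.\<close>
    obtain y z where yz: "p y = a v" "p z = b v" using permutes_surj[OF p] by (metis surjD)
    have Yyz: "y \<in> VY" "z \<in> VY" using yz abY[OF v] p by (metis permutes_in_image)+
    have qyz: "q y = a v" "q z = b v" using yz Yyz disj by (auto simp: q_def)
    obtain g where g: "g \<in> U M N" "g y = q y" "g z = q z" using approx2 by blast
    obtain t where t: "g t = v" using permutes_surj[OF U_permutes[OF g(1)]] by (metis surjD)
    have Et: "E t y" "E t z" using U_E[OF g(1), of t] t g qyz ab[OF v] by metis+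
    have tX: "t \<in> VX" using Et Yyz nbr_VY E_sym by blast
    have "E (q t) (a v)" "E (q t) (b v)" using Et qE qyz by metis+
    then have "q t = v" using common_nbr_unique ab[OF v] E_sym by metis
    with tX show ?thesis by blast
  qed
  have "surj q"
  proof (unfold surj_def, intro allI)
    fix w show "\<exists>t. w = q t"
    proof (cases "w \<in> VX")
      case False
      obtain t where "p t = w" using permutes_surj[OF p] by (metis surjD)
      moreover from this False have "t \<notin> VX" using disj p by (metis disjoint_iff permutes_not_in)
      ultimately show ?thesis by (auto simp: q_def)
    qed (use surjX in blast)
  qed
  with inj have bij: "bij q" by (simp add: bij_def)
  have "q x = x" if "x \<notin> VX \<union> VY" for x
    using that p by (auto simp: q_def permutes_def)
  then have qV: "q permutes (VX \<union> VY)" by (rule bij_moving_only_imp_permutes[OF bij])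
  have qX: "q ` VX = VX" using qVX surjX by blast
  have qVY: "q v \<in> VY" if "v \<in> VY" for v using image_VY[OF qV qX] that by blast
  have "\<exists>m\<in>M. \<forall>w. E v w \<longrightarrow> col (q w) = m (col w)" if v: "v \<in> VX" for v
  proof (rule local_limit[OF bij qE colX[OF v] colX[OF qVX[OF v]] M])
    fix F :: "'v set" assume "finite F"
    then obtain g where "g \<in> U M N" "\<forall>x\<in>F. g x = q x" using approx by blast
    with U_colX[OF _ v] show "\<exists>g. (\<forall>x\<in>F. g x = q x) \<and> (\<exists>m\<in>M. \<forall>w. E v w \<longrightarrow> col (g w) = m (col w))"
      by blast
  qed
  moreover have "\<exists>m\<in>N. \<forall>w. E v w \<longrightarrow> col (q w) = m (col w)" if v: "v \<in> VY" for v
  proof (rule local_limit[OF bij qE colY[OF v] colY[OF qVY[OF v]] N])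
    fix F :: "'v set" assume "finite F"
    then obtain g where "g \<in> U M N" "\<forall>x\<in>F. g x = q x" using approx by blast
    with U_colY[OF _ v] show "\<exists>g. (\<forall>x\<in>F. g x = q x) \<and> (\<exists>m\<in>N. \<forall>w. E v w \<longrightarrow> col (g w) = m (col w))"
      by blast
  qed
  ultimately have "q \<in> U M N" using qV qE qX by (simp add: U_def)
  moreover have "restr q = p"
    using disj p by (auto simp: restr_def q_def fun_eq_iff permutes_def)
  ultimately show "p \<in> restr ` U M N" by blast
qed

section \<open>Finite orbits and compactness of stabilisers\<close>

text \<open>Finiteness travels along a walk from \<open>y\<close>. Leaving a vertex of
  \<open>VY\<close>, the new colour ranges over an orbit of \<open>N\<close>. Leaving a vertex
  \<open>u\<close> of \<open>VX\<close>, a neighbour \<open>t\<close> of \<open>u\<close> with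
  finite orbit serves as reference: once the image of \<open>t\<close> is known, the local element
  lies in a fixed coset of a point stabiliser of \<open>M\<close>.\<close>

lemma finite_orbits_stab:
  assumes M: "perm_group X M" and N: "perm_group Y N"
    and finN: "\<And>z. finite ((\<lambda>n. n z) ` N)"
    and finM: "\<And>x z. x \<in> X \<Longrightarrow> finite ((\<lambda>m. m z) ` stab M x)"
    and y: "y \<in> VY" and z: "z \<in> VY"
  shows "finite {g z | g. g \<in> U M N \<and> g y = y}"
proof -
  define Ob where "Ob w = {g w | g. g \<in> U M N \<and> g y = y}" for w
  \<comment> \<open>Colours are injective on neighbours, so bounding the colours bounds the
    vertices.\<close>
  have nbrs: "finite {w. E u w \<and> col w \<in> C}" if "finite C" for u C
    by (rule inj_on_finite[of col _ C]) (use that col_inj in \<open>auto simp: inj_on_def\<close>)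
  have toX: "finite (Ob w)" if "finite (Ob u)" "u \<in> VY" "E u w" for u w
  proof (rule finite_subset)
    show "Ob w \<subseteq> (\<Union>u'\<in>Ob u. {w'. E u' w' \<and> col w' \<in> (\<lambda>n. n (col w)) ` N})"
    proof
      fix t assume "t \<in> Ob w"
      then obtain g where g: "g \<in> U M N" "g y = y" "t = g w" by (auto simp: Ob_def)
      have "E (g u) t" using g that U_E by metis
      moreover have "col t \<in> (\<lambda>n. n (col w)) ` N" using U_colY[OF g(1) that(2)] that(3) g(3) by blast
      moreover have "g u \<in> Ob u" using g by (auto simp: Ob_def)
      ultimately show "t \<in> (\<Union>u'\<in>Ob u. {w'. E u' w' \<and> col w' \<in> (\<lambda>n. n (col w)) ` N})" by blast
    qed
    show "finite (\<Union>u'\<in>Ob u. {w'. E u' w' \<and> col w' \<in> (\<lambda>n. n (col w)) ` N})"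
      using that nbrs finN by blast
  qed
  have toY: "finite (Ob w)" if "finite (Ob u)" "u \<in> VX" "E u w" "E u t" "finite (Ob t)" for u w t
  proof (rule finite_subset)
    let ?C = "\<lambda>t'. {m (col w) | m. m \<in> M \<and> m (col t) = col t'}"
    show "Ob w \<subseteq> (\<Union>u'\<in>Ob u. \<Union>t'\<in>Ob t. {w'. E u' w' \<and> col w' \<in> ?C t'})"
    proof
      fix s assume "s \<in> Ob w"
      then obtain g where g: "g \<in> U M N" "g y = y" "s = g w" by (auto simp: Ob_def)
      have "E (g u) s" using g that U_E by metis
      moreover have "col s \<in> ?C (g t)" using U_colX[OF g(1) that(2)] that(3,4) g(3) by force
      moreover have "g u \<in> Ob u" "g t \<in> Ob t" using g by (auto simp: Ob_def)
      ultimately show "s \<in> (\<Union>u'\<in>Ob u. \<Union>t'\<in>Ob t. {w'. E u' w' \<and> col w' \<in> ?C t'})" by blast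
    qed
    have "col t \<in> X" using that nbr_VX col_VY by blast
    then have "finite (?C t')" for t' using finite_coset_orbit[OF M] finM by blast
    then show "finite (\<Union>u'\<in>Ob u. \<Union>t'\<in>Ob t. {w'. E u' w' \<and> col w' \<in> ?C t'})"
      using that nbrs by blast
  qed
  have "(y, z) \<in> (arcs E)\<^sup>*" using conn y z by blast
  \<comment> \<open>The extra clause keeps the preceding vertex of the walk as the reference
    neighbour that \<open>toY\<close> needs.\<close>
  then have "finite (Ob z) \<and> (z \<in> VX \<longrightarrow> (\<exists>t. E z t \<and> finite (Ob t)))"
  proof (induction rule: rtrancl_induct)
    case base
    have "Ob y \<subseteq> {y}" by (auto simp: Ob_def)
    then show ?case using y disj finite_subset by blast
  next
    case (step u w)
    then have e: "E u w" by (simp add: arcs_def)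
    show ?case
    proof (cases "u \<in> VX")
      case True
      then show ?thesis using step.IH toY[OF _ True e] nbr_VX[OF True e] disj by blast
    next
      case False
      then have "u \<in> VY" using side[OF e] by blast
      then show ?thesis using step.IH toX[OF _ _ e] E_sym[OF e] by blast
    qed
  qed
  then show ?thesis by (simp add: Ob_def)
qed

lemma orbit_restr_stab:
  assumes "y \<in> VY" "z \<in> VY"
  shows "(\<lambda>g. g z) ` stab (restr ` U M N) y = {g z | g. g \<in> U M N \<and> g y = y}"
proof -
  have "stab (restr ` U M N) y = restr ` {g \<in> U M N. g y = y}"
    using assms(1) by (auto simp: stab_def restr_def)
  then show ?thesis using assms(2) by (auto simp: restr_def image_image)
qed

lemma compact_stab_restr_U:
  assumes M: "perm_group X M" "closedin (sym_top X) M" and N: "perm_group Y N" "closedin (sym_top Y) N"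
    and cN: "compactin (sym_top Y) N" and cM: "\<And>x. x \<in> X \<Longrightarrow> compactin (sym_top X) (stab M x)"
    and y: "y \<in> VY"
  shows "compactin (sym_top VY) (stab (restr ` U M N) y)"
proof (rule compactin_sym_top_finite_orbits)
  show "perm_group VY (stab (restr ` U M N) y)"
    by (intro perm_group_stab perm_group_restr_U M(1) N(1))
  show "closedin (sym_top VY) (stab (restr ` U M N) y)"
    by (intro closedin_sym_top_stab closedin_restr_U M(2) N(2))
  fix z assume z: "z \<in> VY"
  show "finite ((\<lambda>g. g z) ` stab (restr ` U M N) y)"
    unfolding orbit_restr_stab[OF y z]
    by (rule finite_orbits_stab[OF M(1) N(1) _ _ y z])
      (use compactin_sym_top_finite_orbit[OF cN] compactin_sym_top_finite_orbit[OF cM] in blast)+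
qed

text \<open>Local orbits are read off as colours in finite orbits on \<open>VY\<close>. For
  \<open>N\<close> the automorphism fixes a vertex \<open>y\<close> of \<open>VY\<close>; for
  \<open>stab M x\<close> it fixes a vertex of \<open>VX\<close>, and fixing the colour
  \<open>x\<close> makes it fix the neighbour \<open>y\<close> of that colour.\<close>

lemma compact_local_groups:
  assumes M: "perm_group X M" "closedin (sym_top X) M" and N: "perm_group Y N" "closedin (sym_top Y) N"
    and c: "\<And>y. y \<in> VY \<Longrightarrow> compactin (sym_top VY) (stab (restr ` U M N) y)"
  shows "compactin (sym_top Y) N" and "x \<in> X \<Longrightarrow> compactin (sym_top X) (stab M x)"
proof -
  have fin: "finite {g z | g. g \<in> U M N \<and> g y = y}" if "y \<in> VY" "z \<in> VY" for y z
    using compactin_sym_top_finite_orbit[OF c[OF that(1)]] orbit_restr_stab[OF that] by metis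
  show "compactin (sym_top Y) N"
  proof (rule compactin_sym_top_finite_orbits[OF N])
    fix a assume a: "a \<in> Y"
    obtain y where y: "y \<in> VY" using VY_nonempty by blast
    obtain v where v: "E y v" "v \<in> VX" "col v = a" using nbr_Y[OF y a] by blast
    \<comment> \<open>The colour \<open>a\<close> sits on \<open>v\<close>, which is in
      \<open>VX\<close>, while finite orbits are known only on \<open>VY\<close>. Hence the passage
      to a vertex \<open>z\<close> beyond \<open>v\<close>.\<close>
    obtain z where z: "E v z" "z \<noteq> y" using other_nbr[OF v(2)] by blast
    have zY: "z \<in> VY" using nbr_VX v z by blast
    \<comment> \<open>From \<open>t = g z\<close>, at distance two from \<open>y\<close>, the
      \<open>THE\<close> recovers the middle vertex \<open>g v\<close>, whose colour is
      \<open>n a\<close>.\<close>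
    have "(\<lambda>n. n a) ` N \<subseteq> (\<lambda>t. col (THE v. E y v \<and> E v t)) ` {g z | g. g \<in> U M N \<and> g y = y}"
    proof
      fix s assume "s \<in> (\<lambda>n. n a) ` N"
      then obtain n where n: "n \<in> N" "s = n a" by blast
      have np: "n permutes Y" using N n by (auto simp: perm_group_def Sym_def)
      \<comment> \<open>As \<open>X\<close> and \<open>Y\<close> are disjoint, \<open>n\<close> is
        itself a recolouring of both colour sets, and it fixes \<open>col y\<close>, which lies in
        \<open>X\<close>.\<close>
      have nX: "n x = x" if "x \<in> X" for x using np XY that by (auto simp: permutes_def)
      have "\<exists>g\<in>U M N. g y = y \<and> (\<forall>w\<in>VX \<union> VY. col (g w) = n (col w))"
      proof (rule exists_recolouring_automorphism)
        show "\<exists>m\<in>M. \<forall>x\<in>X. m x = n x" using M(1) nX by (intro bexI[of _ id]) (auto simp: perm_group_def)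
        show "n ` X = X" using nX by force
        show "n (col y) = col y" using nX col_VY y by blast
      qed (use y n np permutes_bij permutes_image in blast)+
      then obtain g where g: "g \<in> U M N" "g y = y" "\<forall>w\<in>VX \<union> VY. col (g w) = n (col w)" by blast
      have e: "E y (g v)" "E (g v) (g z)" using U_E[OF g(1)] g(2) v(1) z(1) by metis+
      have "g z \<noteq> y" using z(2) g(2) permutes_inj[OF U_permutes[OF g(1)]] by (metis injD)
      then have "(THE v. E y v \<and> E v (g z)) = g v"
        using e common_nbr_unique E_sym by (intro the_equality) blast+
      then have "s = col (THE v. E y v \<and> E v (g z))" using n g(3) v by simp
      then show "s \<in> (\<lambda>t. col (THE v. E y v \<and> E v t)) ` {g z | g. g \<in> U M N \<and> g y = y}"
        using g by blast
    qed
    then show "finite ((\<lambda>n. n a) ` N)" using fin[OF y zY] finite_surj by blast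
  qed
  show "compactin (sym_top X) (stab M x)" if x: "x \<in> X"
  proof (rule compactin_sym_top_finite_orbits[OF perm_group_stab[OF M(1)] closedin_sym_top_stab[OF M(2)]])
    fix a assume a: "a \<in> X"
    obtain v where v: "v \<in> VX" using VX_nonempty by blast
    obtain y where y: "E v y" "y \<in> VY" "col y = x" using nbr_X[OF v x] by blast
    obtain z where z: "E v z" "z \<in> VY" "col z = a" using nbr_X[OF v a] by blast
    have "(\<lambda>m. m a) ` stab M x \<subseteq> col ` {g z | g. g \<in> U M N \<and> g y = y}"
    proof
      fix s assume "s \<in> (\<lambda>m. m a) ` stab M x"
      then obtain m where m: "m \<in> M" "m x = x" "s = m a" by (auto simp: stab_def)
      have mp: "m permutes X" using M m by (auto simp: perm_group_def Sym_def)
      have mY: "m x = x" if "x \<in> Y" for x using mp XY that by (auto simp: permutes_def)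
      have "\<exists>g\<in>U M N. g v = v \<and> (\<forall>w\<in>VX \<union> VY. col (g w) = m (col w))"
      proof (rule exists_recolouring_automorphism)
        show "\<exists>n\<in>N. \<forall>x\<in>Y. n x = m x" using N(1) mY by (intro bexI[of _ id]) (auto simp: perm_group_def)
        show "m ` Y = Y" using mY by force
        show "m (col v) = col v" using mY col_VX v by blast
      qed (use v m mp permutes_bij permutes_image in blast)+
      then obtain g where g: "g \<in> U M N" "g v = v" "\<forall>w\<in>VX \<union> VY. col (g w) = m (col w)" by blast
      have "E v (g y)" using U_E[OF g(1)] g(2) y(1) by metis
      moreover have "col (g y) = col y" using g(3) y m by simp
      \<comment> \<open>Both \<open>y\<close> and \<open>g y\<close> are neighbours of
        \<open>v\<close> with colour \<open>x\<close>.\<close>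
      ultimately have "g y = y" using col_inj y(1) by blast
      moreover have "s = col (g z)" using g(3) z m by simp
      ultimately show "s \<in> col ` {g z | g. g \<in> U M N \<and> g y = y}" using g(1) by blast
    qed
    then show "finite ((\<lambda>m. m a) ` stab M x)" using fin[OF y(2) z(2)] finite_surj by blast
  qed
qed

end

section \<open>From arc colourings to vertex colourings\<close>

text \<open>The colours of the neighbours exhaust \<open>S\<close>, and both the local action and
  the elements of \<open>K\<close> are the identity off \<open>S\<close>. An element inducing the
  same recolouring therefore equals the local action.\<close>

lemma local_action_mem_iff:
  assumes b: "bij_betw c (arcs_from E v) S" and K: "K \<subseteq> Sym S"
    and g: "\<And>w. E v w \<Longrightarrow> c (g v, g w) = col (g w)" and col: "\<And>w. E v w \<Longrightarrow> c (v, w) = col w"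
  shows "local_action E c g v \<in> K \<longleftrightarrow> (\<exists>m\<in>K. \<forall>w. E v w \<longrightarrow> col (g w) = m (col w))"
proof -
  have im: "c ` arcs_from E v = S" using b by (simp add: bij_betw_def)
  have inS: "col w \<in> S" if "E v w" for w
    using im that col by (force simp: arcs_from_def)
  have la: "local_action E c g v (col w) = col (g w)" if "E v w" for w
  proof -
    have "(THE w'. E v w' \<and> c (v, w') = col w) = w"
    proof (rule the_equality)
      fix w' assume "E v w' \<and> c (v, w') = col w"
      then show "w' = w"
        using b that col inj_onD[of c "arcs_from E v" "(v, w')" "(v, w)"]
        by (auto simp: bij_betw_def arcs_from_def)
    qed (use that col in auto)
    then show ?thesis using that inS im g by (simp add: local_action_def)
  qed
  show ?thesis
  proof
    assume "local_action E c g v \<in> K"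
    then show "\<exists>m\<in>K. \<forall>w. E v w \<longrightarrow> col (g w) = m (col w)"
      using la by (intro bexI[of _ "local_action E c g v"]) auto
  next
    assume "\<exists>m\<in>K. \<forall>w. E v w \<longrightarrow> col (g w) = m (col w)"
    then obtain m where m: "m \<in> K" "\<And>w. E v w \<Longrightarrow> col (g w) = m (col w)" by blast
    have "local_action E c g v = m"
    proof
      fix x
      show "local_action E c g v x = m x"
      proof (cases "x \<in> S")
        case True
        then obtain w where "E v w" "x = c (v, w)" using im by (auto simp: arcs_from_def)
        then show ?thesis using la m col by simp
      next
        case False
        then show ?thesis using m K im by (auto simp: local_action_def Sym_def permutes_def)
      qed
    qed
    with m show "local_action E c g v \<in> K" by simp
  qed
qed

theorem theorem6p1:
  fixes X Y :: "'a set" and VX VY :: "'v set" and E :: "'v \<Rightarrow> 'v \<Rightarrow> bool"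
    and c :: "'v \<times> 'v \<Rightarrow> 'a" and M N :: "('a \<Rightarrow> 'a) set"
  assumes "X \<inter> Y = {}"
    and "\<exists>a\<in>X. \<exists>b\<in>X. a \<noteq> b" and "\<exists>a\<in>Y. \<exists>b\<in>Y. a \<noteq> b"
    and "perm_group X M" and "perm_group Y N"
    and "M \<noteq> {id}" and "N \<noteq> {id}"
    and "closedin (sym_top X) M" and "closedin (sym_top Y) N"
    and "biregular_tree X Y VX VY E"
    and "legal_colouring X Y VX VY E c"
  shows "closedin (sym_top VY) (box_product X Y VX VY E c M N) \<and>
    ((\<forall>y\<in>VY. compactin (sym_top VY) (stab (box_product X Y VX VY E c M N) y))
     \<longleftrightarrow> (compactin (sym_top Y) N \<and> (\<forall>x\<in>X. compactin (sym_top X) (stab M x))))"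
proof -
  \<comment> \<open>Any arc into \<open>w\<close> would do, since \<open>c\<close> is constant on
    them.\<close>
  define col where "col w = c (SOME u. E u w, w)" for w
  have tree: "is_tree (VX \<union> VY) E" "VX \<inter> VY = {}"
    "\<And>u w. E u w \<Longrightarrow> (u \<in> VX \<and> w \<in> VY) \<or> (u \<in> VY \<and> w \<in> VX)"
    using assms(10) by (auto simp: biregular_tree_def)
  have leg: "\<And>v. v \<in> VX \<Longrightarrow> bij_betw c (arcs_from E v) X"
    "\<And>v. v \<in> VY \<Longrightarrow> bij_betw c (arcs_from E v) Y"
    "\<And>u u' w. E u w \<Longrightarrow> E u' w \<Longrightarrow> c (u, w) = c (u', w)"
  proof -
    show "c (u, w) = c (u', w)" if "E u w" "E u' w" for u u' w
    proof -
      have "(u, w) \<in> arcs_to E w" "(u', w) \<in> arcs_to E w" using that by (auto simp: arcs_to_def)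
      then show ?thesis using assms(11) unfolding legal_colouring_def by blast
    qed
  qed (use assms(11) in \<open>simp_all add: legal_colouring_def\<close>)
  have col: "c (u, w) = col w" if "E u w" for u w
    unfolding col_def using leg(3)[OF that someI[of "\<lambda>u. E u w", OF that]] .
  have bc: "bij_betw col {w. E v w} S" if "bij_betw c (arcs_from E v) S" for v S
  proof -
    have "bij_betw (Pair v) {w. E v w} (arcs_from E v)"
      by (auto simp: bij_betw_def inj_on_def arcs_from_def)
    then have "bij_betw (c \<circ> Pair v) {w. E v w} S" using that bij_betw_trans by blast
    then show ?thesis by (rule bij_betw_cong[THEN iffD1, rotated]) (simp add: col)
  qed
  interpret coloured_tree X Y VX VY E col
  proof
    fix u w
    show "E w u" if "E u w" using tree(1) that unfolding is_tree_def by blast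
    show "(u, w) \<in> (arcs E)\<^sup>*" if "u \<in> VX \<union> VY" "w \<in> VX \<union> VY"
      using tree(1) that unfolding is_tree_def by blast
    show "(u, w) \<notin> (arcs E - {(u, w), (w, u)})\<^sup>*" if "E u w"
      using tree(1) that unfolding is_tree_def by blast
    show "VX \<union> VY \<noteq> {}" using tree(1) unfolding is_tree_def by blast
    show "(u \<in> VX \<and> w \<in> VY) \<or> (u \<in> VY \<and> w \<in> VX)" if "E u w" using tree(3)[OF that] .
    show "bij_betw col {w. E u w} X" if "u \<in> VX" using bc[OF leg(1)[OF that]] .
    show "bij_betw col {w. E u w} Y" if "u \<in> VY" using bc[OF leg(2)[OF that]] .
    show "VX \<inter> VY = {}" using tree(2) .
    show "\<exists>a\<in>X. \<exists>b\<in>X. a \<noteq> b" "\<exists>a\<in>Y. \<exists>b\<in>Y. a \<noteq> b" "X \<inter> Y = {}"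
      using assms(2) assms(3) assms(1) .
  qed
  have EV: "u \<in> VX \<union> VY \<and> w \<in> VX \<union> VY" if "E u w" for u w using tree(3) that by blast
  have "U_c X Y VX VY E c M N = U M N"
  proof -
    have aut: "g \<in> graph_aut (VX \<union> VY) E \<longleftrightarrow> g permutes (VX \<union> VY) \<and> (\<forall>u w. E (g u) (g w) \<longleftrightarrow> E u w)" for g
    proof -
      have "(\<forall>u\<in>VX \<union> VY. \<forall>w\<in>VX \<union> VY. E u w \<longleftrightarrow> E (g u) (g w)) \<longleftrightarrow> (\<forall>u w. E (g u) (g w) \<longleftrightarrow> E u w)"
        if "g permutes (VX \<union> VY)"
        using EV permutes_in_image[OF that] by meson
      then show ?thesis unfolding graph_aut_def by blast
    qed
    have loc: "local_action E c g v \<in> K \<longleftrightarrow> (\<exists>m\<in>K. \<forall>w. E v w \<longrightarrow> col (g w) = m (col w))"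
      if "\<forall>u w. E (g u) (g w) \<longleftrightarrow> E u w" "bij_betw c (arcs_from E v) S" "K \<subseteq> Sym S" for g v K S
      by (rule local_action_mem_iff[OF that(2,3)]) (use that(1) col in auto)
    have "M \<subseteq> Sym X" "N \<subseteq> Sym Y" using assms(4,5) by (auto simp: perm_group_def)
    then have locM: "local_action E c g v \<in> M \<longleftrightarrow> (\<exists>m\<in>M. \<forall>w. E v w \<longrightarrow> col (g w) = m (col w))"
      if "\<forall>u w. E (g u) (g w) \<longleftrightarrow> E u w" "v \<in> VX" for g v
      using loc[OF that(1) leg(1)[OF that(2)]] by blast
    have locN: "local_action E c g v \<in> N \<longleftrightarrow> (\<exists>n\<in>N. \<forall>w. E v w \<longrightarrow> col (g w) = n (col w))"
      if "\<forall>u w. E (g u) (g w) \<longleftrightarrow> E u w" "v \<in> VY" for g v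
      using loc[OF that(1) leg(2)[OF that(2)]] \<open>N \<subseteq> Sym Y\<close> by blast
    from locM locN show ?thesis
      unfolding U_c_def U_def aut by (intro Collect_cong) (simp cong: conj_cong)
  qed
  then have box: "box_product X Y VX VY E c M N = restr ` U M N"
    by (simp add: box_product_def restr_def)
  show ?thesis
    unfolding box
    using closedin_restr_U[OF assms(8,9)] compact_stab_restr_U[OF assms(4,8,5,9)]
      compact_local_groups[OF assms(4,8,5,9)] by blast
qed

end
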